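(* Let $\alpha\in(0,2)$, $\beta\in(-1,1)$, $T>0$, $J\in\mathbb{N}$, $h=1/J$, $x_j=jh$, and let $f,g,\sigma$ be real coefficient functions with $\sigma$ nowhere zero. Let $\tilde R=A+B$ be the discrete spatial operator, and $\hat N$, $C_{2,\beta}$ the functions, defined in the context. Put $I_h=\{j\in\mathbb{Z}:|jh|<1\}$, $I_{h,T}=I_h\times(0,T]$ and $\partial I_{h,T}=(\mathbb{Z}\times[0,T])\setminus I_{h,T}$. Assume $\hat N(x)\le0$ and $C_{2,\beta}(x)\ge0$ for $x\in(-1,1)$. Let $U_j(t)$, $j\in\mathbb{Z}$, $t\in[0,T]$, be grid functions (continuous on $[0,T]$ and differentiable on $(0,T]$ in $t$). (i) If $\frac{dU_j}{dt}-(\tilde R\mathbf U)_j\le0$ for $(j,t)\in I_{h,T}$ and $U_j=0$ for $|j|\ge J$, then $$\max_{(j,t)\in\mathbb{Z}\times[0,T]}U_j(t)=\max_{(j,t)\in\partial I_{h,T}}U_j(t).$$ (ii) If $\frac{dU_j}{dt}-(\tilde R\mathbf U)_j\ge0$ for $(j,t)\in I_{h,T}$ and $U_j=0$ for $|j|\ge J$, then $$\min_{(j,t)\in\mathbb{Z}\times[0,T]}U_j(t)=\min_{(j,t)\in\partial I_{h,T}}U_j(t).$$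
   Context: The operator $\tilde R$ is the spatial discretization, on $(-1,1)$ with absorbing boundary condition, of the Fokker-Planck equation (in the unknown $u=|\sigma|^\alpha p$) of $dX_t=f(X_t)dt+g(X_t)dB_t+\sigma(X_{t-})dL^{\alpha,\beta}_t$ with $L^{\alpha,\beta}$ asymmetric $\alpha$-stable. The functions $f,g,\sigma$ are assumed differentiable as often as the formulas require. Constants: $C_\alpha=\frac{\alpha(1-\alpha)}{\Gamma(2-\alpha)\cos(\pi\alpha/2)}$ for $\alpha\ne1$, $C_1=2/\pi$; $C_p(\beta)=C_\alpha\frac{1+\beta}2$, $C_n(\beta)=C_\alpha\frac{1-\beta}2$; $\zeta$ is the Riemann zeta function. Functions: $C_{1,\beta}(x)=C_p(\beta)1_{\{\sigma(x)>0\}}+C_n(\beta)1_{\{\sigma(x)<0\}}$, $\quad C_{2,\beta}(x)=\beta C_\alpha1_{\{\sigma(x)<0\}}-\beta C_\alpha1_{\{\sigma(x)>0\}}$ (so $C_{1,\beta}+C_{2,\beta}=C_{1,-\beta}$); $M(x)=|\sigma(x)|^\alpha\big(\frac{g^2(x)}{|\sigma(x)|^\alpha}\big)'-f(x)$, $\quad N(x)=\frac12|\sigma(x)|^\alpha\big(\frac{g^2(x)}{|\sigma(x)|^\alpha}\big)''-|\sigma(x)|^\alpha\big(\frac{f(x)}{|\sigma(x)|^\alpha}\big)'$; $\hat M(x)=M(x)-|\sigma(x)|^\alpha\frac{C_{2,\beta}(x)}{1-\alpha}\big[|\sigma(x)|^{1-\alpha}-(1-x)^{1-\alpha}\big]$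 if $|\sigma(x)|>1-x$, and $\hat M(x)=M(x)$ if $|\sigma(x)|<1-x$; $\hat N(x)=N(x)+\beta C_\alpha\sigma'(x)-|\sigma(x)|^\alpha\frac{C_{1,-\beta}(x)}\alpha(1-x)^{-\alpha}-|\sigma(x)|^\alpha\frac{C_{1,\beta}(x)}\alpha(1+x)^{-\alpha}$. Discrete operators, for $|j|<J$, with $\mathbf U=(U_{-J+1},\dots,U_{J-1})^T$ and $U_j=0$ for $|j|\ge J$: $$(A\mathbf U)_j=C_h\frac{U_{j+1}-2U_j+U_{j-1}}{h^2}+\hat M(x_j)\delta_uU_j+\hat N(x_j)U_j,\qquad C_h=\frac{g^2(x_j)}2-\frac{C_\alpha|\sigma(x_j)|^\alpha}2\zeta(\alpha-1)h^{2-\alpha},$$ where $\delta_u$ is the upwind difference: $\delta_uU_j=\frac{U_j-U_{j-1}}h$ if $\hat M(x_j)<0$ and $\frac{U_{j+1}-U_j}h$ if $\hat M(x_j)>0$. If $|\sigma(x_j)|+x_j>1$, $$(B\mathbf U)_j=|\sigma(x_j)|^\alpha C_{1,\beta}(x_j)h\sum_{k=1-J,k\ne j}^{J-1}\frac{U_k-U_j}{|x_k-x_j|^{1+\alpha}}+|\sigma(x_j)|^\alpha C_{2,\beta}(x_j)h{\sum_{k=j+1}^{J}}'\frac{U_k-U_j-(x_k-x_j)\frac{U_j-U_{j-1}}h}{|x_k-x_j|^{1+\alpha}};$$ if $|\sigma(x_j)|+x_j<1$, with $m$ the integer part of $|\sigma(x_j)|/h$, $$(B\mathbf U)_j=|\sigma(x_j)|^\alpha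 C_{1,\beta}(x_j)h\sum_{k=1-J,k\ne j}^{J-1}\frac{U_k-U_j}{|x_k-x_j|^{1+\alpha}}+|\sigma(x_j)|^\alpha C_{2,\beta}(x_j)h\Big[{\sum_{k=j+1}^{j+m}}'\frac{U_k-U_j-(x_k-x_j)\frac{U_j-U_{j-1}}h}{|x_k-x_j|^{1+\alpha}}+\sum_{k=j+m}^{J}\frac{U_k-U_j}{|x_k-x_j|^{1+\alpha}}\Big].$$ Here $\sum$ means the terms of both end indices are multiplied by $\frac12$, and $\sum'$ means only the term of the top index is multiplied by $\frac12$. It is implicitly assumed that every expression is well defined (in particular $\alpha\neq1$ whenever the factor $\frac1{1-\alpha}$ occurs, $|\sigma(x_j)|+x_j\ne1$, and $h$ is small enough that $m\ge1$ in the second case). *)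

theory Defs
  imports "HOL-Complex_Analysis.Complex_Analysis"
begin

text \<open>
  The Riemann zeta function as the unique analytic continuation of the Dirichlet series to
  the plane without the point 1; the value at the pole is fixed to be 0 only so that the
  description determines a total function. It is needed here on the real interval \<open>(-1, 1)\<close>,
  outside the half-plane of convergence.
\<close>

definition riemann_zeta :: "complex \<Rightarrow> complex" where
  "riemann_zeta = (THE F. F holomorphic_on (- {1}) \<and> F 1 = 0 \<and>
     (\<forall>s. Re s > 1 \<longrightarrow> (\<lambda>n. of_nat (Suc n) powr (- s)) sums F s))"

definition zeta_real :: "real \<Rightarrow> real" where
  "zeta_real s = Re (riemann_zeta (complex_of_real s))"


definition C_const :: "real \<Rightarrow> real" where
  "C_const \<alpha> = (if \<alpha> = 1 then 2 / pi
     else \<alpha> * (1 - \<alpha>) / (Gamma (2 - \<alpha>) * cos (pi * \<alpha> / 2)))"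

definition C_p :: "real \<Rightarrow> real \<Rightarrow> real" where
  "C_p \<alpha> \<beta> = C_const \<alpha> * ((1 + \<beta>) / 2)"

definition C_n :: "real \<Rightarrow> real \<Rightarrow> real" where
  "C_n \<alpha> \<beta> = C_const \<alpha> * ((1 - \<beta>) / 2)"

definition C1 :: "real \<Rightarrow> real \<Rightarrow> (real \<Rightarrow> real) \<Rightarrow> real \<Rightarrow> real" where
  "C1 \<alpha> \<beta> \<sigma> x = C_p \<alpha> \<beta> * of_bool (\<sigma> x > 0) + C_n \<alpha> \<beta> * of_bool (\<sigma> x < 0)"

definition C2 :: "real \<Rightarrow> real \<Rightarrow> (real \<Rightarrow> real) \<Rightarrow> real \<Rightarrow> real" where
  "C2 \<alpha> \<beta> \<sigma> x = \<beta> * C_const \<alpha> * of_bool (\<sigma> x < 0) - \<beta> * C_const \<alpha> * of_bool (\<sigma> x > 0)"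

definition M_fun ::
  "real \<Rightarrow> (real \<Rightarrow> real) \<Rightarrow> (real \<Rightarrow> real) \<Rightarrow> (real \<Rightarrow> real) \<Rightarrow> real \<Rightarrow> real" where
  "M_fun \<alpha> f g \<sigma> x =
     \<bar>\<sigma> x\<bar> powr \<alpha> * deriv (\<lambda>y. (g y)\<^sup>2 / \<bar>\<sigma> y\<bar> powr \<alpha>) x - f x"

definition N_fun ::
  "real \<Rightarrow> (real \<Rightarrow> real) \<Rightarrow> (real \<Rightarrow> real) \<Rightarrow> (real \<Rightarrow> real) \<Rightarrow> real \<Rightarrow> real" where
  "N_fun \<alpha> f g \<sigma> x =
     1 / 2 * \<bar>\<sigma> x\<bar> powr \<alpha> * deriv (deriv (\<lambda>y. (g y)\<^sup>2 / \<bar>\<sigma> y\<bar> powr \<alpha>)) x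
     - \<bar>\<sigma> x\<bar> powr \<alpha> * deriv (\<lambda>y. f y / \<bar>\<sigma> y\<bar> powr \<alpha>) x"

text \<open>
  The formula does not prescribe a value when \<open>\<bar>\<sigma> x\<bar> = 1 - x\<close>; here and in \<open>op_B\<close> that case
  falls into the last branch, and it is excluded at the grid points by \<open>scheme_well_defined\<close>.
\<close>

definition M_hat ::
  "real \<Rightarrow> real \<Rightarrow> (real \<Rightarrow> real) \<Rightarrow> (real \<Rightarrow> real) \<Rightarrow> (real \<Rightarrow> real) \<Rightarrow> real \<Rightarrow> real" where
  "M_hat \<alpha> \<beta> f g \<sigma> x =
     (if \<bar>\<sigma> x\<bar> > 1 - x
      then M_fun \<alpha> f g \<sigma> x - \<bar>\<sigma> x\<bar> powr \<alpha> * (C2 \<alpha> \<beta> \<sigma> x / (1 - \<alpha>)) *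
             (\<bar>\<sigma> x\<bar> powr (1 - \<alpha>) - (1 - x) powr (1 - \<alpha>))
      else M_fun \<alpha> f g \<sigma> x)"

definition N_hat ::
  "real \<Rightarrow> real \<Rightarrow> (real \<Rightarrow> real) \<Rightarrow> (real \<Rightarrow> real) \<Rightarrow> (real \<Rightarrow> real) \<Rightarrow> real \<Rightarrow> real" where
  "N_hat \<alpha> \<beta> f g \<sigma> x =
     N_fun \<alpha> f g \<sigma> x + \<beta> * C_const \<alpha> * deriv \<sigma> x
     - \<bar>\<sigma> x\<bar> powr \<alpha> * (C1 \<alpha> (- \<beta>) \<sigma> x / \<alpha>) * (1 - x) powr (- \<alpha>)
     - \<bar>\<sigma> x\<bar> powr \<alpha> * (C1 \<alpha> \<beta> \<sigma> x / \<alpha>) * (1 + x) powr (- \<alpha>)"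


definition step :: "nat \<Rightarrow> real" where
  "step J = 1 / real J"

definition gridpt :: "nat \<Rightarrow> int \<Rightarrow> real" where
  "gridpt J j = real_of_int j * step J"

definition I_grid :: "nat \<Rightarrow> int set" where
  "I_grid J = {j. \<bar>real_of_int j * step J\<bar> < 1}"

definition I_cyl :: "nat \<Rightarrow> real \<Rightarrow> (int \<times> real) set" where
  "I_cyl J T = I_grid J \<times> {0<..T}"

definition bdry_I_cyl :: "nat \<Rightarrow> real \<Rightarrow> (int \<times> real) set" where
  "bdry_I_cyl J T = (UNIV \<times> {0..T}) - I_cyl J T"

text \<open>
  Weights of the modified sums over \<open>k = a, \<dots>, b\<close>: \<open>w_ends\<close> halves the terms with the two end
  indices, \<open>w_top\<close> (the primed sum) halves only the term with the top index.
\<close>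

definition w_ends :: "int \<Rightarrow> int \<Rightarrow> int \<Rightarrow> real" where
  "w_ends a b k = (if k = a \<or> k = b then 1 / 2 else 1)"

definition w_top :: "int \<Rightarrow> int \<Rightarrow> real" where
  "w_top b k = (if k = b then 1 / 2 else 1)"

definition C_h :: "real \<Rightarrow> (real \<Rightarrow> real) \<Rightarrow> (real \<Rightarrow> real) \<Rightarrow> nat \<Rightarrow> int \<Rightarrow> real" where
  "C_h \<alpha> g \<sigma> J j =
     (g (gridpt J j))\<^sup>2 / 2
     - C_const \<alpha> * \<bar>\<sigma> (gridpt J j)\<bar> powr \<alpha> / 2 * zeta_real (\<alpha> - 1) * step J powr (2 - \<alpha>)"

text \<open>
  Upwind difference for the drift coefficient \<open>c\<close>. The choice made for \<open>c = 0\<close> is irrelevant,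
  because the difference only occurs multiplied by \<open>c\<close>.
\<close>

definition upwind :: "real \<Rightarrow> nat \<Rightarrow> (int \<Rightarrow> real) \<Rightarrow> int \<Rightarrow> real" where
  "upwind c J V j =
     (if c < 0 then (V j - V (j - 1)) / step J else (V (j + 1) - V j) / step J)"

definition op_A ::
  "real \<Rightarrow> real \<Rightarrow> (real \<Rightarrow> real) \<Rightarrow> (real \<Rightarrow> real) \<Rightarrow> (real \<Rightarrow> real) \<Rightarrow> nat \<Rightarrow>
   (int \<Rightarrow> real) \<Rightarrow> int \<Rightarrow> real" where
  "op_A \<alpha> \<beta> f g \<sigma> J V j =
     C_h \<alpha> g \<sigma> J j * ((V (j + 1) - 2 * V j + V (j - 1)) / (step J)\<^sup>2)
     + M_hat \<alpha> \<beta> f g \<sigma> (gridpt J j) * upwind (M_hat \<alpha> \<beta> f g \<sigma> (gridpt J j)) J V j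
     + N_hat \<alpha> \<beta> f g \<sigma> (gridpt J j) * V j"

definition m_idx :: "(real \<Rightarrow> real) \<Rightarrow> nat \<Rightarrow> int \<Rightarrow> int" where
  "m_idx \<sigma> J j = \<lfloor>\<bar>\<sigma> (gridpt J j)\<bar> / step J\<rfloor>"

definition quot_plain :: "real \<Rightarrow> nat \<Rightarrow> (int \<Rightarrow> real) \<Rightarrow> int \<Rightarrow> int \<Rightarrow> real" where
  "quot_plain \<alpha> J V j k =
     (V k - V j) / \<bar>gridpt J k - gridpt J j\<bar> powr (1 + \<alpha>)"

definition quot_comp :: "real \<Rightarrow> nat \<Rightarrow> (int \<Rightarrow> real) \<Rightarrow> int \<Rightarrow> int \<Rightarrow> real" where
  "quot_comp \<alpha> J V j k =
     (V k - V j - (gridpt J k - gridpt J j) * ((V j - V (j - 1)) / step J))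
       / \<bar>gridpt J k - gridpt J j\<bar> powr (1 + \<alpha>)"

definition op_B ::
  "real \<Rightarrow> real \<Rightarrow> (real \<Rightarrow> real) \<Rightarrow> nat \<Rightarrow> (int \<Rightarrow> real) \<Rightarrow> int \<Rightarrow> real" where
  "op_B \<alpha> \<beta> \<sigma> J V j =
     (let x = gridpt J j; s = \<bar>\<sigma> x\<bar> powr \<alpha>; h = step J; m = m_idx \<sigma> J j in
        s * C1 \<alpha> \<beta> \<sigma> x * h *
          (\<Sum>k\<in>{1 - int J..int J - 1} - {j}.
             w_ends (1 - int J) (int J - 1) k * quot_plain \<alpha> J V j k)
        + s * C2 \<alpha> \<beta> \<sigma> x * h *
          (if \<bar>\<sigma> x\<bar> + x > 1
           then \<Sum>k=j+1..int J. w_top (int J) k * quot_comp \<alpha> J V j k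
           else (\<Sum>k=j+1..j+m. w_top (j + m) k * quot_comp \<alpha> J V j k)
                + (\<Sum>k=j+m..int J. w_ends (j + m) (int J) k * quot_plain \<alpha> J V j k)))"

definition op_R ::
  "real \<Rightarrow> real \<Rightarrow> (real \<Rightarrow> real) \<Rightarrow> (real \<Rightarrow> real) \<Rightarrow> (real \<Rightarrow> real) \<Rightarrow> nat \<Rightarrow>
   (int \<Rightarrow> real) \<Rightarrow> int \<Rightarrow> real" where
  "op_R \<alpha> \<beta> f g \<sigma> J V j = op_A \<alpha> \<beta> f g \<sigma> J V j + op_B \<alpha> \<beta> \<sigma> J V j"

text \<open>
  Conditions under which all expressions in the scheme are meaningful: the factor
  \<open>1 / (1 - \<alpha>)\<close> enters only through \<open>M_hat\<close> at grid points with \<open>\<bar>\<sigma> x\<bar> > 1 - x\<close>, and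
  the last sum in \<open>op_B\<close> must not contain the index \<open>k = j\<close>.
\<close>

definition scheme_well_defined :: "real \<Rightarrow> (real \<Rightarrow> real) \<Rightarrow> nat \<Rightarrow> bool" where
  "scheme_well_defined \<alpha> \<sigma> J \<longleftrightarrow>
     (\<forall>j\<in>I_grid J.
        \<bar>\<sigma> (gridpt J j)\<bar> + gridpt J j \<noteq> 1 \<and>
        (\<bar>\<sigma> (gridpt J j)\<bar> + gridpt J j > 1 \<longrightarrow> \<alpha> \<noteq> 1) \<and>
        (\<bar>\<sigma> (gridpt J j)\<bar> + gridpt J j < 1 \<longrightarrow> m_idx \<sigma> J j \<ge> 1))"


text \<open>Attained extrema over possibly infinite index sets, for which \<open>Max\<close> is unsuitable.\<close>

definition is_max_over :: "('a \<Rightarrow> real) \<Rightarrow> 'a set \<Rightarrow> real \<Rightarrow> bool" where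
  "is_max_over \<phi> S m \<longleftrightarrow> (\<exists>p\<in>S. \<phi> p = m) \<and> (\<forall>p\<in>S. \<phi> p \<le> m)"

definition is_min_over :: "('a \<Rightarrow> real) \<Rightarrow> 'a set \<Rightarrow> real \<Rightarrow> bool" where
  "is_min_over \<phi> S m \<longleftrightarrow> (\<exists>p\<in>S. \<phi> p = m) \<and> (\<forall>p\<in>S. m \<le> \<phi> p)"

end

theory Submission
  imports Defs
begin

text \<open>
  Written as a combination of differences \<open>V k - V j\<close> plus \<open>N_hat V j\<close>, the operator has
  nonnegative coefficients on all differences, so it is \<open>\<le> 0\<close> at a nonnegative maximum. If \<open>U\<close>
  exceeded the largest boundary value somewhere, \<open>U j t - \<epsilon> t\<close> would for small \<open>\<epsilon> > 0\<close> have an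
  interior maximum in \<open>j\<close> and \<open>t\<close>, where \<open>dU j t \<ge> \<epsilon>\<close> contradicts \<open>dU j t \<le> 0\<close>.

  The only coefficient whose sign is not evident is \<open>C_h\<close>, which needs \<open>\<zeta> \<le> 0\<close> on \<open>(-1, 1)\<close>.
  Summing the Taylor expansion of \<open>(n + 1)\<^sup>-\<^sup>w - n\<^sup>-\<^sup>w\<close> over \<open>n\<close> expresses \<open>G s = (s - 1) \<zeta>(s)\<close> by
  \<open>G (s + 1), \<dots>, G (s + m)\<close> and a remainder holomorphic in a larger half-plane, so \<open>G\<close> is
  entire. For \<open>m = 1\<close> this is the trapezoidal rule for \<open>x\<^sup>-\<^sup>s\<close>, whose errors are estimated by
  concavity for \<open>s \<le> 0\<close> and by monotonicity for \<open>s > 0\<close>.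
\<close>

section \<open>Continuation of the zeta function\<close>

text \<open>Taylor remainder of x^(-w), expanded about n + 1 and evaluated at n + 2; the increment
  is 1, so its powers do not appear. The shift by one keeps all base points positive.\<close>

definition powr_rem :: "nat \<Rightarrow> nat \<Rightarrow> complex \<Rightarrow> complex" where
  "powr_rem K n w = of_nat (n + 2) powr (- w)
     - (\<Sum>k\<le>K. ((- w) gchoose k) * of_nat (Suc n) powr (- w - of_nat k))"

text \<open>These products are falling factorials, the coefficients in the derivatives of x^a; the
  identity passes from one derivative to the next.\<close>

lemma fact_Suc_gbinomial:
  "fact (Suc i) * ((a::complex) gchoose Suc i) = fact i * (a gchoose i) * (a - of_nat i)"
  by (simp add: gbinomial_mult_fact atLeast0_lessThan_Suc mult.commute del: fact_Suc)

text \<open>Taylor's formula on the segment from n + 1 to n + 2. By assumption the exponent in the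
  derivative of order K + 1 has nonpositive real part, so the modulus is largest at the left
  end.\<close>

lemma norm_powr_rem_le:
  assumes "Re w + real K + 1 \<ge> 0"
  shows "norm (powr_rem K n w)
     \<le> norm (fact (Suc K) * ((- w) gchoose Suc K)) * real (Suc n) powr (- Re w - real K - 1)"
proof -
  define S where "S = closed_segment (of_nat (Suc n)) (of_nat (n + 2) :: complex)"
  define f where "f i x = fact i * ((- w) gchoose i) * x powr (- w - of_nat i)" for i and x :: complex
  define B where "B = norm (fact (Suc K) * ((- w) gchoose Suc K)) * real (Suc n) powr (- Re w - real K - 1)"
  have S: "\<exists>r. x = of_real r \<and> r \<ge> real (Suc n)" if "x \<in> S" for x
  proof -
    have "S = of_real ` closed_segment (real (Suc n)) (real (n + 2))"
      unfolding S_def by (metis closed_segment_of_real of_real_of_nat_eq)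
    with that show ?thesis by (auto simp: closed_segment_eq_real_ivl)
  qed
  have "cmod (f 0 (of_nat (n + 2)) - (\<Sum>i\<le>K. f i (of_nat (Suc n)) * (of_nat (n + 2) - of_nat (Suc n)) ^ i / fact i))
     \<le> B * cmod (of_nat (n + 2) - of_nat (Suc n)) ^ Suc K / fact K"
  proof (rule complex_Taylor[where S = S])
    show "convex S" "of_nat (Suc n) \<in> S" "of_nat (n + 2) \<in> S" by (simp_all add: S_def)
  next
    fix i x assume "x \<in> S" "i \<le> K"
    then obtain r where r: "x = of_real r" "r \<ge> real (Suc n)" using S by blast
    then have "x \<notin> \<real>\<^sub>\<le>\<^sub>0" by (auto simp: complex_nonpos_Reals_iff)
    then show "(f i has_field_derivative f (Suc i) x) (at x within S)"
      unfolding f_def fact_Suc_gbinomial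
      by (auto intro!: derivative_eq_intros simp: algebra_simps)
  next
    fix x assume "x \<in> S"
    then obtain r where r: "x = of_real r" "r \<ge> real (Suc n)" using S by blast
    have "norm (x powr (- w - of_nat (Suc K))) = r powr (- Re w - real K - 1)"
      using r by (subst norm_powr_real_powr) (auto simp: algebra_simps)
    also have "\<dots> \<le> real (Suc n) powr (- Re w - real K - 1)"
      using r assms by (intro powr_mono2') auto
    finally show "cmod (f (Suc K) x) \<le> B"
      unfolding f_def B_def norm_mult by (intro mult_left_mono) auto
  qed
  moreover have "f 0 (of_nat (n + 2)) - (\<Sum>i\<le>K. f i (of_nat (Suc n)) * (of_nat (n + 2) - of_nat (Suc n)) ^ i / fact i)
      = powr_rem K n w"
    by (simp add: f_def powr_rem_def)
  \<comment> \<open>The factor 1 / K! from Taylor's formula is dropped; only the decay in n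
    matters.\<close>
  moreover have "B \<ge> 0" by (simp add: B_def)
  then have "B / fact K \<le> B" by (simp add: divide_le_eq fact_ge_1 mult_left_le mult_right_mono mult_le_cancel_left1)
  ultimately show ?thesis by (simp add: B_def)
qed

definition rem_sum :: "nat \<Rightarrow> complex \<Rightarrow> complex" where
  "rem_sum K w = (\<Sum>n. powr_rem K n w)"

lemma powr_rem_uniform:
  assumes "Re w + real K > 0"
  obtains d where "d > 0" "cball w d \<subseteq> {w. Re w + real K > 0}"
    "uniform_limit (cball w d) (\<lambda>N w. \<Sum>n<N. powr_rem K n w) (rem_sum K) sequentially"
proof -
  \<comment> \<open>Half the distance from \<open>w\<close> to the line Re = -K. On the ball this
    leaves Re v + K \<ge> d, so the terms are dominated by the summable sequence (n +
    1)^(-d-1).\<close>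
  define d where "d = (Re w + real K) / 2"
  have d: "d > 0" using assms by (simp add: d_def)
  have Re: "Re v + real K \<ge> d" if "v \<in> cball w d" for v
    using that abs_Re_le_cmod[of "w - v"] by (simp add: d_def dist_norm)
  have "bounded ((\<lambda>w. fact (Suc K) * ((- w) gchoose Suc K)) ` cball w d)"
    unfolding gbinomial_mult_fact
    by (intro compact_imp_bounded compact_continuous_image continuous_intros compact_cball)
  then obtain C where C: "\<And>v. v \<in> cball w d \<Longrightarrow> norm (fact (Suc K) * ((- v) gchoose Suc K)) \<le> C"
    unfolding bounded_iff by blast
  have "C \<ge> 0" using C[of w] d by (meson centre_in_cball less_imp_le norm_ge_zero order_trans)
  have le: "norm (powr_rem K n v) \<le> C * real (Suc n) powr (- d - 1)" if v: "v \<in> cball w d" for n v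
  proof -
    have "norm (powr_rem K n v) \<le> norm (fact (Suc K) * ((- v) gchoose Suc K)) * real (Suc n) powr (- Re v - real K - 1)"
      using Re[OF v] d by (intro norm_powr_rem_le) simp
    also have "\<dots> \<le> C * real (Suc n) powr (- d - 1)"
      using Re[OF v] C[OF v] \<open>C \<ge> 0\<close> by (intro mult_mono powr_mono) auto
    finally show ?thesis .
  qed
  have "summable (\<lambda>n. real n powr (- d - 1))"
    using d by (simp add: summable_real_powr_iff)
  then have "summable (\<lambda>n. C * real (Suc n) powr (- d - 1))"
    by (intro summable_mult) (subst (asm) summable_Suc_iff[symmetric], simp)
  then have "uniform_limit (cball w d) (\<lambda>N w. \<Sum>n<N. powr_rem K n w) (rem_sum K) sequentially"
    unfolding rem_sum_def using le by (intro Weierstrass_m_test)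
  moreover have "cball w d \<subseteq> {w. Re w + real K > 0}" using Re d by fastforce
  ultimately show ?thesis using d that by blast
qed

lemma powr_rem_sums:
  assumes "Re w + real K > 0"
  shows "(\<lambda>n. powr_rem K n w) sums rem_sum K w"
proof -
  obtain d where "d > 0" "uniform_limit (cball w d) (\<lambda>N w. \<Sum>n<N. powr_rem K n w) (rem_sum K) sequentially"
    using powr_rem_uniform[OF assms] by metis
  then show ?thesis unfolding sums_def by (auto intro: tendsto_uniform_limitI)
qed

lemma holomorphic_gbinomial [holomorphic_intros]:
  assumes "f holomorphic_on A"
  shows "(\<lambda>z. f z gchoose k) holomorphic_on A"
  unfolding gbinomial_prod_rev using assms by (intro holomorphic_intros) auto

text \<open>A locally uniform limit of holomorphic partial sums. Each further Taylor term gains one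
  power of n and so moves the half-plane one unit to the left.\<close>

lemma holomorphic_rem_sum: "rem_sum K holomorphic_on {w. Re w + real K > 0}"
proof (rule holomorphic_uniform_sequence)
  have "{w. Re w + real K > 0} = {w. Re w > - real K}" by auto
  then show "open {w. Re w + real K > 0}" by (simp add: open_halfspace_Re_gt)
  show "(\<lambda>w. \<Sum>n<N. powr_rem K n w) holomorphic_on {w. Re w + real K > 0}" for N
    unfolding powr_rem_def
    by (intro holomorphic_intros) (auto simp: complex_nonpos_Reals_iff simp del: of_nat_Suc of_nat_add)
  show "\<exists>d>0. cball w d \<subseteq> {w. Re w + real K > 0} \<and>
      uniform_limit (cball w d) (\<lambda>N w. \<Sum>n<N. powr_rem K n w) (rem_sum K) sequentially"
    if "w \<in> {w. Re w + real K > 0}" for w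
    using that powr_rem_uniform[of w K] by (metis mem_Collect_eq)
qed

section \<open>The Dirichlet series and its recurrence\<close>

definition dirichlet :: "complex \<Rightarrow> complex" where
  "dirichlet s = (\<Sum>n. of_nat (Suc n) powr (- s))"

lemma dirichlet_sums:
  assumes "Re s > 1"
  shows "(\<lambda>n. of_nat (Suc n) powr (- s)) sums dirichlet s"
proof -
  have "summable (\<lambda>n. real n powr (- Re s))" using assms by (simp add: summable_real_powr_iff)
  then have "summable (\<lambda>n. real (Suc n) powr (- Re s))" by (subst (asm) summable_Suc_iff[symmetric])
  then have "summable (\<lambda>n. complex_of_nat (Suc n) powr (- s))"
    by (rule summable_comparison_test') (subst norm_powr_real_powr, auto)
  then show ?thesis unfolding dirichlet_def by (rule summable_sums)
qed

text \<open>Sum the Taylor remainders of x^(1-s) over n. The differences telescope to -1, and the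
  Taylor term of order l + 1 sums to a multiple of \<open>dirichlet (s + of_nat l)\<close>. Its
  coefficient contains the factor s + l - 1, so the recurrence involves only values of (z - 1)
  \<zeta>(z).\<close>

lemma dirichlet_recurrence:
  assumes "Re s > 1"
  shows "(\<Sum>l\<le>m. ((1 - s) gchoose l) / of_nat (Suc l) * ((s + of_nat l - 1) * dirichlet (s + of_nat l)))
     = 1 + rem_sum (Suc m) (s - 1)"
proof -
  let ?c = "\<lambda>l. ((1 - s) gchoose l) / of_nat (Suc l) * (s + of_nat l - 1)"
  let ?p = "\<lambda>n. complex_of_nat (Suc n) powr (1 - s)"
  have lim: "?p \<longlonglongrightarrow> 0"
  proof (rule tendsto_norm_zero_cancel)
    have "(\<lambda>n. real (Suc n) powr (1 - Re s)) \<longlonglongrightarrow> 0"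
      using assms by real_asymp
    then show "(\<lambda>n. norm (?p n)) \<longlonglongrightarrow> 0"
      by (subst norm_powr_real_powr) auto
  qed
  have "(\<lambda>n. (?p (Suc n) - ?p n) + (\<Sum>l\<le>m. ?c l * of_nat (Suc n) powr (- (s + of_nat l))))
      sums ((0 - ?p 0) + (\<Sum>l\<le>m. ?c l * dirichlet (s + of_nat l)))"
    using assms lim
    by (intro sums_add sums_sum sums_mult dirichlet_sums telescope_sums) auto
  also have "(\<lambda>n. (?p (Suc n) - ?p n) + (\<Sum>l\<le>m. ?c l * of_nat (Suc n) powr (- (s + of_nat l))))
     = (\<lambda>n. powr_rem (Suc m) n (s - 1))"
  proof
    fix n
    have "((1 - s) gchoose Suc l) = - ?c l" for l
    proof -
      have "of_nat (Suc l) * ((1 - s) gchoose Suc l) = ((1 - s) gchoose l) * (1 - s - of_nat l)"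
        using fact_Suc_gbinomial[of l "1 - s"] by simp
      then show ?thesis by (simp add: field_simps del: of_nat_Suc)
    qed
    then have "((1 - s) gchoose Suc l) * of_nat (Suc n) powr (1 - s - of_nat (Suc l))
        = - (?c l * of_nat (Suc n) powr (- (s + of_nat l)))" for l
      by (simp add: algebra_simps del: of_nat_Suc) (simp add: algebra_simps)
    then have "(\<Sum>l\<le>m. ((1 - s) gchoose Suc l) * of_nat (Suc n) powr (1 - s - of_nat (Suc l)))
        = - (\<Sum>l\<le>m. ?c l * of_nat (Suc n) powr (- (s + of_nat l)))"
      by (simp only: sum_negf)
    then show "(?p (Suc n) - ?p n) + (\<Sum>l\<le>m. ?c l * of_nat (Suc n) powr (- (s + of_nat l)))
       = powr_rem (Suc m) n (s - 1)"
      unfolding powr_rem_def sum.atMost_Suc_shift minus_diff_eq by simp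
  qed
  finally have "(\<lambda>n. powr_rem (Suc m) n (s - 1))
      sums ((0 - ?p 0) + (\<Sum>l\<le>m. ?c l * dirichlet (s + of_nat l)))" .
  from sums_unique2[OF this powr_rem_sums] assms show ?thesis
    by (simp add: mult.assoc diff_eq_eq add.commute)
qed

text \<open>Induction on \<open>m\<close>: the recurrence is solved for its term l = 0. The other
  terms are values of the previous continuation at s + l with l \<ge> 1, and the remainder sum of
  order m + 2 at s - 1 is holomorphic for Re s > -(m + 1), which gains one unit.\<close>

lemma zeta_continuation_halfplane:
  "\<exists>G. G holomorphic_on {s. Re s > - real m} \<and> (\<forall>s. Re s > 1 \<longrightarrow> G s = (s - 1) * dirichlet s)"
proof (induction m)
  case 0
  have "(\<lambda>s. 1 + rem_sum 1 (s - 1)) holomorphic_on {s. Re s > - real 0}"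
    by (intro holomorphic_intros holomorphic_on_compose_gen[OF _ holomorphic_rem_sum, unfolded o_def]) auto
  moreover have "1 + rem_sum 1 (s - 1) = (s - 1) * dirichlet s" if "Re s > 1" for s
    using dirichlet_recurrence[OF that, of 0] by simp
  ultimately show ?case by blast
next
  case (Suc m)
  then obtain G where G: "G holomorphic_on {s. Re s > - real m}"
    and G_eq: "\<And>s. Re s > 1 \<Longrightarrow> G s = (s - 1) * dirichlet s" by blast
  let ?G = "\<lambda>s. 1 + rem_sum (Suc (Suc m)) (s - 1)
     - (\<Sum>l\<in>{1..Suc m}. ((1 - s) gchoose l) / of_nat (Suc l) * G (s + of_nat l))"
  have "?G holomorphic_on {s. Re s > - real (Suc m)}"
    by (intro holomorphic_intros holomorphic_on_compose_gen[OF _ G, unfolded o_def]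
        holomorphic_on_compose_gen[OF _ holomorphic_rem_sum, unfolded o_def]) (auto simp: of_nat_neq_0)
  moreover have "?G s = (s - 1) * dirichlet s" if s: "Re s > 1" for s
  proof -
    have "{..Suc m} = insert 0 {1..Suc m}" by auto
    moreover have "G (s + of_nat l) = (s + of_nat l - 1) * dirichlet (s + of_nat l)" for l
      using s by (intro G_eq) simp
    ultimately show ?thesis
      using dirichlet_recurrence[OF s, of "Suc m"]
      by (simp add: of_nat_Suc[of 0] eq_diff_eq diff_eq_eq del: of_nat_Suc sum.atMost_Suc sum.cl_ivl_Suc)
  qed
  ultimately show ?case by blast
qed

text \<open>Identity theorem on a half-plane, which is connected; where Re s > 1 the claim is an
  assumption.\<close>

lemma halfplane_continuation_unique:
  assumes "F holomorphic_on {s. Re s > a}" "G holomorphic_on {s. Re s > a}"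
    and "\<And>s. Re s > 1 \<Longrightarrow> F s = G s" and "Re s > a"
  shows "F s = G s"
proof (cases "Re s > 1")
  case False
  with \<open>Re s > a\<close> have "a < 1" by simp
  show ?thesis
  proof (rule analytic_continuation_open[of "{s. Re s > 1}" "{s. Re s > a}" F G])
    show "{s. Re s > 1} \<noteq> {}" by (auto intro: exI[of _ 2])
    show "connected {s. Re s > a}" by (intro convex_connected convex_halfspace_Re_gt)
  qed (use assms \<open>a < 1\<close> in \<open>auto simp: open_halfspace_Re_gt\<close>)
qed (use assms in auto)

lemma zeta_continuation:
  obtains G where "G holomorphic_on UNIV" "\<And>s. Re s > 1 \<Longrightarrow> G s = (s - 1) * dirichlet s"
proof -
  obtain G where G: "\<And>m. G m holomorphic_on {s. Re s > - real m}"
    and G_eq: "\<And>m s. Re s > 1 \<Longrightarrow> G m s = (s - 1) * dirichlet s"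
    using zeta_continuation_halfplane by metis
  \<comment> \<open>The index chosen at \<open>s\<close> is at least 1 - Re s, so its half-plane
    contains \<open>s\<close>. By uniqueness on the smaller of two half-planes the choice does not
    affect the value.\<close>
  define F where "F s = G (nat \<lceil>1 - Re s\<rceil>) s" for s
  have F_eq: "F s = G m s" if "Re s > - real m" for m s
    unfolding F_def
  proof (rule halfplane_continuation_unique[where F = "G (nat \<lceil>1 - Re s\<rceil>)" and G = "G m"
        and a = "- real (min m (nat \<lceil>1 - Re s\<rceil>))"])
    let ?a = "- real (min m (nat \<lceil>1 - Re s\<rceil>))"
    show "G m holomorphic_on {z. Re z > ?a}" "G (nat \<lceil>1 - Re s\<rceil>) holomorphic_on {z. Re z > ?a}"
      by (auto intro: holomorphic_on_subset[OF G])
    have "real (nat \<lceil>1 - Re s\<rceil>) \<ge> 1 - Re s" by linarith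
    then show "Re s > ?a" using that by (auto simp: min_def)
  qed (simp add: G_eq)
  have "F holomorphic_on (\<Union>m\<in>UNIV. {s. Re s > - real m})"
  proof (rule holomorphic_on_UN_open)
    show "F holomorphic_on {s. Re s > - real m}" for m
      using G[of m] by (rule holomorphic_transform) (simp add: F_eq)
    show "open {s. Re s > - real m}" for m by (simp add: open_halfspace_Re_gt)
  qed
  also have "(\<Union>m. {s. Re s > - real m}) = UNIV"
  proof (intro equalityI subsetI UN_I)
    fix s :: complex
    show "s \<in> {z. Re z > - real (nat \<lceil>1 - Re s\<rceil>)}" unfolding mem_Collect_eq by linarith
  qed auto
  finally show ?thesis using that G_eq F_def by metis
qed

text \<open>The definite description has exactly one solution: the punctured plane is connected, so
  the values for Re s > 1 determine the function off 1, and the value at 1 is prescribed.\<close>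

lemma riemann_zeta_eq:
  assumes G: "G holomorphic_on UNIV" and G_eq: "\<And>s. Re s > 1 \<Longrightarrow> G s = (s - 1) * dirichlet s"
    and "s \<noteq> 1"
  shows "riemann_zeta s = G s / (s - 1)"
proof -
  let ?F = "\<lambda>s. if s = 1 then 0 else G s / (s - 1)"
  have "(\<lambda>s. G s / (s - 1)) holomorphic_on - {1}"
    by (intro holomorphic_intros holomorphic_on_subset[OF G]) auto
  then have hol: "?F holomorphic_on - {1}" by (rule holomorphic_transform) auto
  have "riemann_zeta = ?F"
    unfolding riemann_zeta_def
  proof (rule the_equality, intro conjI allI impI)
    show "(\<lambda>n. of_nat (Suc n) powr - s) sums ?F s" if "Re s > 1" for s
      using dirichlet_sums[OF that] G_eq[OF that] that by auto
  next
    fix F assume F: "F holomorphic_on - {1} \<and> F 1 = 0 \<and>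
      (\<forall>s. Re s > 1 \<longrightarrow> (\<lambda>n. of_nat (Suc n) powr - s) sums F s)"
    show "F = ?F"
    proof
      fix s
      show "F s = ?F s"
      proof (cases "s = 1")
        case False
        show ?thesis
        proof (rule analytic_continuation_open[of "{s. Re s > 1}" "- {1}" F ?F])
          show "{s. Re s > 1} \<noteq> {}" by (auto intro: exI[of _ 2])
          show "connected (- {1 :: complex})" by (intro connected_punctured_universe) simp
          show "F z = ?F z" if "z \<in> {s. Re s > 1}" for z
            using F that sums_unique2[OF _ dirichlet_sums[of z]] G_eq[of z] by auto
        qed (use F hol False in \<open>auto simp: open_halfspace_Re_gt\<close>)
      qed (use F in simp)
    qed
  qed (use hol in auto)
  from fun_cong[OF this, of s] \<open>s \<noteq> 1\<close> show ?thesis by simp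
qed

section \<open>The sign of zeta on the interval from -1 to 1\<close>

text \<open>Since t^a is concave, the trapezoid under its chord has at most the area under the
  graph; both areas are multiplied by 1 + a.\<close>

lemma powr_trapezoid_le:
  fixes a u v :: real
  assumes a: "0 \<le> a" "a \<le> 1" and uv: "0 < u" "u \<le> v"
  shows "(1 + a) / 2 * (v - u) * (u powr a + v powr a) \<le> v powr (1 + a) - u powr (1 + a)"
proof -
  \<comment> \<open>The right endpoint becomes the variable. The derivative of \<open>D\<close> is
    nonnegative because the tangent to t^a at the right endpoint lies above the graph at
    \<open>u\<close>.\<close>
  define D where "D t = t powr (1 + a) - (1 + a) / 2 * (t - u) * (u powr a + t powr a)" for t
  have "D u \<le> D v"
  proof (rule DERIV_nonneg_imp_nondecreasing[OF uv(2)])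
    fix t assume t: "u \<le> t" "t \<le> v"
    then have "t > 0" using uv by simp
    have "(D has_real_derivative
        (1 + a) * t powr a - (1 + a) / 2 * ((u powr a + t powr a) + (t - u) * (a * t powr (a - 1)))) (at t)"
      unfolding D_def using \<open>t > 0\<close> by (auto intro!: derivative_eq_intros simp: field_simps)
    moreover have "(t - u) * (a * t powr (a - 1)) \<le> t powr a - u powr a"
    proof (cases "u = t")
      case False
      then have "\<exists>z. u < z \<and> z < t \<and> t powr a - u powr a = (t - u) * (a * z powr (a - 1))"
        using t uv by (intro MVT2) (auto intro!: derivative_eq_intros)
      then obtain z where z: "u < z" "z < t" "t powr a - u powr a = (t - u) * (a * z powr (a - 1))" by blast
      have "t powr (a - 1) \<le> z powr (a - 1)" using z uv a by (intro powr_mono2') auto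
      then show ?thesis using z a by (simp add: mult_left_mono)
    qed simp
    then have "(1 + a) / 2 * (t powr a - u powr a - (t - u) * (a * t powr (a - 1))) \<ge> 0"
      using a by simp
    ultimately show "\<exists>y. (D has_real_derivative y) (at t) \<and> 0 \<le> y"
      by (intro exI conjI) (auto simp: field_simps)
  qed
  then show ?thesis by (simp add: D_def)
qed

text \<open>The derivative a t^(a-1) is nonincreasing, so its integral is at least the length times
  its value at the right endpoint.\<close>

lemma powr_rectangle_le:
  fixes a u v :: real
  assumes "0 \<le> a" "a \<le> 1" "0 < u" "u < v"
  shows "a * (v - u) * v powr (a - 1) \<le> v powr a - u powr a"
proof -
  have "\<exists>z. u < z \<and> z < v \<and> v powr a - u powr a = (v - u) * (a * z powr (a - 1))"
    using assms by (intro MVT2) (auto intro!: derivative_eq_intros)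
  then obtain z where z: "u < z" "z < v" "v powr a - u powr a = (v - u) * (a * z powr (a - 1))" by blast
  have "v powr (a - 1) \<le> z powr (a - 1)" using z assms by (intro powr_mono2') auto
  then have "(v - u) * (a * v powr (a - 1)) \<le> (v - u) * (a * z powr (a - 1))"
    using assms by (intro mult_left_mono) auto
  then show ?thesis using z(3) by (simp add: mult_ac)
qed

lemma zeta_real_nonpos:
  assumes x: "- 1 < x" "x < 1"
  shows "zeta_real x \<le> 0"
proof -
  obtain G where G: "G holomorphic_on UNIV" and G_eq: "\<And>s. Re s > 1 \<Longrightarrow> G s = (s - 1) * dirichlet s"
    using zeta_continuation by metis
  have G1: "G s = 1 + rem_sum 1 (s - 1)" if "Re s > 0" for s
  proof (rule halfplane_continuation_unique[where F = G and G = "\<lambda>s. 1 + rem_sum 1 (s - 1)" and a = 0])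
    show "(\<lambda>s. 1 + rem_sum 1 (s - 1)) holomorphic_on {s. Re s > 0}"
      by (intro holomorphic_intros holomorphic_on_compose_gen[OF _ holomorphic_rem_sum, unfolded o_def]) auto
    show "G s = 1 + rem_sum 1 (s - 1)" if "Re s > 1" for s
      using dirichlet_recurrence[OF that, of 0] G_eq[OF that] by simp
  qed (use that in \<open>auto intro: holomorphic_on_subset[OF G]\<close>)
  have G2: "G s + (1 - s) / 2 * G (s + 1) = 1 + rem_sum 2 (s - 1)" if "Re s > - 1" for s
  proof (rule halfplane_continuation_unique[where F = "\<lambda>s. G s + (1 - s) / 2 * G (s + 1)"
        and G = "\<lambda>s. 1 + rem_sum 2 (s - 1)" and a = "- 1"])
    show "(\<lambda>s. 1 + rem_sum 2 (s - 1)) holomorphic_on {s. Re s > - 1}"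
      by (intro holomorphic_intros holomorphic_on_compose_gen[OF _ holomorphic_rem_sum, unfolded o_def]) auto
    show "(\<lambda>s. G s + (1 - s) / 2 * G (s + 1)) holomorphic_on {s. Re s > - 1}"
      by (intro holomorphic_intros holomorphic_on_compose_gen[OF _ G, unfolded o_def] holomorphic_on_subset[OF G]) auto
    show "G s + (1 - s) / 2 * G (s + 1) = 1 + rem_sum 2 (s - 1)" if "Re s > 1" for s
      using dirichlet_recurrence[OF that, of 1] G_eq[OF that] G_eq[of "s + 1"] that by (simp add: numeral_2_eq_2)
  qed (use that in auto)
  let ?s = "complex_of_real x"
  define p where "p n = real (Suc n) powr (- x)" for n
  define q where "q n = real (Suc n) powr (1 - x)" for n
  \<comment> \<open>Up to the factor 1 - x, this is the integral of t^(-x) from n + 1 to n + 2 minus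
    its trapezoidal approximation.\<close>
  define \<tau> where "\<tau> n = (x - 1) / 2 * (p n + p (Suc n)) - (q n - q (Suc n))" for n
  \<comment> \<open>The terms in (n + 1)^(-s-1) of the two remainders cancel.\<close>
  have "powr_rem 2 n (?s - 1) + (?s - 1) / 2 * powr_rem 1 n ?s = of_real (\<tau> n)" for n
  proof -
    have of_p: "of_nat (Suc n) powr (- ?s) = of_real (p n)" for n
      unfolding p_def by (subst powr_of_real[symmetric]) auto
    have of_q: "of_nat (Suc n) powr (1 - ?s) = of_real (q n)" for n
      unfolding q_def by (subst powr_of_real[symmetric]) auto
    have choose: "(1 - ?s) gchoose Suc (Suc 0) = - (1 - ?s) * ?s / 2"
      by (simp add: gbinomial_prod_rev algebra_simps)
    have minus: "- ?s - 1 = - 1 - ?s" by simp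
    show ?thesis
      using of_p[of n] of_p[of "Suc n"] of_q[of n] of_q[of "Suc n"]
      by (simp add: powr_rem_def \<tau>_def numeral_2_eq_2 choose minus) (simp add: field_simps)
  qed
  then have "(\<lambda>n. of_real (\<tau> n)) sums (rem_sum 2 (?s - 1) + (?s - 1) / 2 * rem_sum 1 ?s)"
    using sums_add[OF powr_rem_sums[of "?s - 1" 2] sums_mult[OF powr_rem_sums[of ?s 1], of "(?s - 1) / 2"]] x
    by simp
  also have "rem_sum 2 (?s - 1) + (?s - 1) / 2 * rem_sum 1 ?s = G ?s - (1 + (?s - 1) / 2)"
  proof -
    have "G ?s = 1 + rem_sum 2 (?s - 1) - (1 - ?s) / 2 * (1 + rem_sum 1 ?s)"
      using G1[of "?s + 1"] G2[of ?s] x by (simp add: eq_diff_eq)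
    then show ?thesis by (simp only:) (simp add: field_simps)
  qed
  \<comment> \<open>Hence G(x) is (1 + x)/2 plus the sum of the trapezoidal errors; as x - 1 < 0, it
    remains to show that this is nonnegative.\<close>
  finally have \<tau>: "\<tau> sums (Re (G ?s) - (1 + x) / 2)"
    using sums_Re by (fastforce simp: field_simps)
  have "Re (G ?s) \<ge> 0"
  proof (cases "x \<le> 0")
    case True
    have "\<tau> n \<ge> 0" for n
    proof -
      have "(1 - x) / 2 * (p n + p (Suc n)) \<le> q (Suc n) - q n"
        using powr_trapezoid_le[of "- x" "real (Suc n)" "real (Suc (Suc n))"] x True
        by (simp add: p_def q_def)
      then show ?thesis by (simp add: \<tau>_def field_simps)
    qed
    then have "Re (G ?s) - (1 + x) / 2 \<ge> 0" by (rule sums_le[OF _ sums_zero \<tau>])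
    then show ?thesis using x by simp
  next
    case False
    \<comment> \<open>For x > 0 the errors may be negative, but a telescoping lower bound sums to (x
      - 1)/2, which leaves G(x) \<ge> x.\<close>
    have "p \<longlonglongrightarrow> 0" unfolding p_def using False by real_asymp
    then have lower: "(\<lambda>n. (x - 1) / 2 * (p n - p (Suc n))) sums ((x - 1) / 2 * (p 0 - 0))"
      by (intro sums_mult telescope_sums')
    have "(x - 1) / 2 * (p n - p (Suc n)) \<le> \<tau> n" for n
    proof -
      have "(1 - x) * p (Suc n) \<le> q (Suc n) - q n"
        using powr_rectangle_le[of "1 - x" "real (Suc n)" "real (Suc (Suc n))"] x False
        by (simp add: p_def q_def)
      then show ?thesis by (simp add: \<tau>_def field_simps)
    qed
    then have "(x - 1) / 2 * (p 0 - 0) \<le> Re (G ?s) - (1 + x) / 2"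
      by (rule sums_le[OF _ lower \<tau>])
    then show ?thesis using False by (simp add: p_def field_simps)
  qed
  moreover have "zeta_real x = Re (G ?s) / (x - 1)"
  proof -
    have "riemann_zeta ?s = G ?s / of_real (x - 1)"
      using riemann_zeta_eq[OF G G_eq] x by simp
    then show ?thesis by (simp add: zeta_real_def del: of_real_diff)
  qed
  ultimately show ?thesis using x by (simp add: divide_nonneg_neg)
qed

section \<open>The maximum principle\<close>

text \<open>1 - \<alpha> and cos(\<pi>\<alpha>/2) change sign together at \<alpha> = 1, so their
  quotient is positive on both sides.\<close>

lemma C_const_pos:
  assumes "0 < \<alpha>" "\<alpha> < 2"
  shows "C_const \<alpha> > 0"
proof (cases "\<alpha> = 1")
  case False
  have "(1 - \<alpha>) / cos (pi * \<alpha> / 2) > 0"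
  proof (cases "\<alpha> < 1")
    case True
    then have "cos (pi * \<alpha> / 2) > 0"
      using assms by (intro cos_gt_zero_pi) (auto simp: field_simps intro: less_le_trans[of _ 0])
    then show ?thesis using True by simp
  next
    case False
    with \<open>\<alpha> \<noteq> 1\<close> have "\<alpha> > 1" by simp
    have "cos (pi - pi * \<alpha> / 2) > 0"
      using assms \<open>\<alpha> > 1\<close> by (intro cos_gt_zero) (auto simp: field_simps)
    then show ?thesis using \<open>\<alpha> > 1\<close> by (simp add: divide_neg_neg)
  qed
  moreover have "\<alpha> / Gamma (2 - \<alpha>) > 0" using assms by (simp add: Gamma_real_pos)
  ultimately have "\<alpha> / Gamma (2 - \<alpha>) * ((1 - \<alpha>) / cos (pi * \<alpha> / 2)) > 0" by (rule mult_pos_pos[rotated])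
  then show ?thesis using False by (simp add: C_const_def)
qed (simp add: C_const_def)

lemma C1_nonneg:
  assumes "0 < \<alpha>" "\<alpha> < 2" "- 1 < \<beta>" "\<beta> < 1"
  shows "C1 \<alpha> \<beta> \<sigma> x \<ge> 0"
  using C_const_pos[OF assms(1,2)] assms(3,4) by (simp add: C1_def C_p_def C_n_def)

text \<open>Here \<alpha> - 1 lies between -1 and 1, so zeta is nonpositive there and the subtracted
  term only increases the diffusion coefficient.\<close>

lemma C_h_nonneg:
  assumes "0 < \<alpha>" "\<alpha> < 2"
  shows "C_h \<alpha> g \<sigma> J j \<ge> 0"
proof -
  let ?c = "C_const \<alpha> * \<bar>\<sigma> (gridpt J j)\<bar> powr \<alpha> / 2 * step J powr (2 - \<alpha>)"
  have "?c \<ge> 0" using C_const_pos[OF assms] by simp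
  moreover have "zeta_real (\<alpha> - 1) \<le> 0" using assms by (intro zeta_real_nonpos) auto
  ultimately have "?c * zeta_real (\<alpha> - 1) \<le> 0" by (rule mult_nonneg_nonpos)
  then show ?thesis by (simp add: C_h_def mult_ac) (smt (verit) zero_le_power2)
qed

text \<open>Every difference V k - V j is nonpositive. The compensated quotients keep this sign
  because they look only to the right and subtract a backward difference, which is nonnegative at a
  maximum. Upwinding makes the drift term nonpositive for either sign of its coefficient; the
  zeroth-order term uses V j \<ge> 0.\<close>

lemma op_R_nonpos_at_max:
  assumes "0 < \<alpha>" "\<alpha> < 2" "- 1 < \<beta>" "\<beta> < 1" "J \<ge> 1"
    and "N_hat \<alpha> \<beta> f g \<sigma> (gridpt J j) \<le> 0" "C2 \<alpha> \<beta> \<sigma> (gridpt J j) \<ge> 0"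
    and max: "\<And>k. V k \<le> V j" and "V j \<ge> 0"
  shows "op_R \<alpha> \<beta> f g \<sigma> J V j \<le> 0"
proof -
  have step: "step J > 0" using assms(5) by (simp add: step_def)
  have plain: "quot_plain \<alpha> J V j k \<le> 0" for k
    unfolding quot_plain_def using max[of k] by (intro divide_nonpos_nonneg) auto
  have comp: "quot_comp \<alpha> J V j k \<le> 0" if "j \<le> k" for k
  proof -
    have "(gridpt J k - gridpt J j) * ((V j - V (j - 1)) / step J) \<ge> 0"
      using that step max by (intro mult_nonneg_nonneg divide_nonneg_pos) (auto simp: gridpt_def mult_right_mono)
    then show ?thesis
      unfolding quot_comp_def using max[of k] by (intro divide_nonpos_nonneg) auto
  qed
  have w: "w_ends a b k \<ge> 0" "w_top b k \<ge> 0" for a b k by (simp_all add: w_ends_def w_top_def)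
  have "op_A \<alpha> \<beta> f g \<sigma> J V j \<le> 0"
  proof -
    have "C_h \<alpha> g \<sigma> J j * ((V (j + 1) - 2 * V j + V (j - 1)) / (step J)\<^sup>2) \<le> 0"
      using C_h_nonneg assms(1,2) max[of "j + 1"] max[of "j - 1"]
      by (intro mult_nonneg_nonpos divide_nonpos_nonneg) auto
    moreover have "c * upwind c J V j \<le> 0" for c
      using step max[of "j + 1"] max[of "j - 1"]
      by (auto simp: upwind_def mult_le_0_iff zero_le_divide_iff divide_le_0_iff)
    moreover have "N_hat \<alpha> \<beta> f g \<sigma> (gridpt J j) * V j \<le> 0"
      using assms by (intro mult_nonpos_nonneg) auto
    ultimately show ?thesis unfolding op_A_def by (intro add_nonpos_nonpos)
  qed
  moreover have "op_B \<alpha> \<beta> \<sigma> J V j \<le> 0"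
    unfolding op_B_def Let_def
    using assms C1_nonneg step plain comp w
    by (intro add_nonpos_nonpos mult_nonneg_nonpos)
      (auto intro!: sum_nonpos add_nonpos_nonpos mult_nonneg_nonpos mult_nonneg_nonneg)
  ultimately show ?thesis by (simp add: op_R_def)
qed

lemma op_R_uminus: "op_R \<alpha> \<beta> f g \<sigma> J (\<lambda>k. - V k) j = - op_R \<alpha> \<beta> f g \<sigma> J V j"
proof -
  have plain: "quot_plain \<alpha> J (\<lambda>k. - V k) j k = - quot_plain \<alpha> J V j k" for k
    by (simp add: quot_plain_def diff_divide_distrib)
  have comp: "quot_comp \<alpha> J (\<lambda>k. - V k) j k = - quot_comp \<alpha> J V j k" for k
    unfolding quot_comp_def minus_divide_left by (rule arg_cong2[where f = "(/)"]) (simp_all add: diff_divide_distrib algebra_simps)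
  \<comment> \<open>The upwind direction depends on the sign of \<open>c\<close> and not on the grid
    function, so linearity is preserved.\<close>
  have up: "upwind c J (\<lambda>k. - V k) j = - upwind c J V j" for c
    by (simp add: upwind_def diff_divide_distrib)
  have lap: "- V (j + 1) - 2 * - V j + - V (j - 1) = - (V (j + 1) - 2 * V j + V (j - 1))" by simp
  have if_neg: "(if P then - x else - y) = - (if P then x else y)" for P and x y :: real by simp
  show ?thesis
    unfolding op_R_def op_A_def op_B_def Let_def plain comp up lap
    by (simp only: mult_minus_right minus_divide_left[symmetric] sum_negf minus_add_distrib[symmetric] if_neg)
qed

text \<open>The scheme enters only through \<open>max\<close>. Subtracting \<epsilon> t turns its
  weak inequality into a strictly negative time derivative, which rules out a maximum at a positive
  time. Only earlier times are compared, so the final time T is covered by its one-sided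
  derivative.\<close>

lemma bounded_by_initial_and_outer_values:
  fixes U dU :: "'a \<Rightarrow> real \<Rightarrow> real"
  assumes "finite I"
    and cont: "\<And>j. j \<in> I \<Longrightarrow> continuous_on {0..T} (U j)"
    and deriv: "\<And>j t. j \<in> I \<Longrightarrow> t \<in> {0<..T} \<Longrightarrow> (U j has_real_derivative dU j t) (at t within {0..T})"
    and init: "\<And>j. j \<in> I \<Longrightarrow> U j 0 \<le> b"
    and outer: "\<And>j t. j \<notin> I \<Longrightarrow> t \<in> {0..T} \<Longrightarrow> U j t \<le> b"
    and max: "\<And>j t. j \<in> I \<Longrightarrow> t \<in> {0<..T} \<Longrightarrow> (\<And>k. U k t \<le> U j t) \<Longrightarrow> b \<le> U j t \<Longrightarrow> dU j t \<le> 0"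
    and t: "t \<in> {0..T}"
  shows "U j t \<le> b"
proof (rule ccontr)
  assume "\<not> U j t \<le> b"
  then have gt: "U j t > b" by simp
  then have "j \<in> I" using outer t by force
  have "t \<noteq> 0" using gt init[OF \<open>j \<in> I\<close>] by auto
  then have "T > 0" using t by auto
  \<comment> \<open>With this choice \<epsilon> T is half the excess over \<open>b\<close>, so the
    perturbed value at \<open>(j, t)\<close> still exceeds \<open>b\<close>.\<close>
  define \<epsilon> where "\<epsilon> = (U j t - b) / (2 * T)"
  have "\<epsilon> > 0" using gt \<open>T > 0\<close> by (simp add: \<epsilon>_def)
  define w where "w k s = U k s - \<epsilon> * s" for k s
  have "\<epsilon> * t \<le> \<epsilon> * T" using t \<open>\<epsilon> > 0\<close> by simp
  also have "\<dots> = (U j t - b) / 2" using \<open>T > 0\<close> by (simp add: \<epsilon>_def)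
  finally have w_gt: "w j t > b" using gt by (simp add: w_def field_simps)
  have "\<exists>s\<in>{0..T}. \<forall>r\<in>{0..T}. w k r \<le> w k s" if "k \<in> I" for k
    unfolding w_def using \<open>T > 0\<close> cont[OF that]
    by (intro continuous_attains_sup continuous_intros) auto
  then obtain s where s: "\<And>k. k \<in> I \<Longrightarrow> s k \<in> {0..T}" "\<And>k r. k \<in> I \<Longrightarrow> r \<in> {0..T} \<Longrightarrow> w k r \<le> w k (s k)"
    by metis
  have "Max ((\<lambda>k. w k (s k)) ` I) \<in> (\<lambda>k. w k (s k)) ` I"
    using \<open>finite I\<close> \<open>j \<in> I\<close> by (intro Max_in) auto
  then obtain i where "i \<in> I" and "Max ((\<lambda>k. w k (s k)) ` I) = w i (s i)" by blast
  then have i: "i \<in> I" "\<And>k. k \<in> I \<Longrightarrow> w k (s k) \<le> w i (s i)"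
    using Max_ge[of "(\<lambda>k. w k (s k)) ` I"] \<open>finite I\<close> by auto
  have top: "w k r \<le> w i (s i)" if "k \<in> I" "r \<in> {0..T}" for k r
    using s(2)[OF that] i(2)[OF that(1)] by simp
  have "w i (s i) > b" using w_gt top[OF \<open>j \<in> I\<close> t] by simp
  then have "s i \<noteq> 0" using init[OF i(1)] by (auto simp: w_def)
  then have si: "s i \<in> {0<..T}" using s(1)[OF i(1)] by auto
  then have "\<epsilon> * s i > 0" using \<open>\<epsilon> > 0\<close> by simp
  then have U_gt: "U i (s i) > b" using \<open>w i (s i) > b\<close> by (simp add: w_def)
  \<comment> \<open>At a fixed time the perturbation is the same for all indices, so a maximum of
    \<open>w\<close> is one of \<open>U\<close>; outside \<open>I\<close> the values are at most
    \<open>b\<close>.\<close>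
  have "U k (s i) \<le> U i (s i)" for k
  proof (cases "k \<in> I")
    case True
    then show ?thesis using top[of k "s i"] si by (simp add: w_def)
  next
    case False
    then show ?thesis using outer[of k "s i"] U_gt si by simp
  qed
  then have "dU i (s i) \<le> 0" using max[OF i(1) si] U_gt by simp
  moreover have "(w i has_real_derivative dU i (s i) - \<epsilon>) (at (s i) within {0..T})"
    unfolding w_def using deriv[OF i(1) si] by (auto intro!: derivative_eq_intros)
  ultimately obtain d where d: "d > 0" "\<And>h. h > 0 \<Longrightarrow> s i - h \<in> {0..T} \<Longrightarrow> h < d \<Longrightarrow> w i (s i) < w i (s i - h)"
    using has_real_derivative_neg_dec_left[of "w i" "dU i (s i) - \<epsilon>" "s i" "{0..T}"] \<open>\<epsilon> > 0\<close> by auto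
  \<comment> \<open>Halving \<open>d\<close> gives strict inequality, and the bound by
    \<open>s i\<close> keeps the earlier time nonnegative.\<close>
  define h where "h = min (d / 2) (s i)"
  have "0 < h" "h < d" "h \<le> s i" using d(1) si by (auto simp: h_def min_less_iff_disj)
  then show False using d(2)[of h] top[OF i(1), of "s i - h"] si by auto
qed

section \<open>The comparison argument applied to the scheme\<close>

lemma I_grid_eq:
  assumes "J \<ge> 1"
  shows "I_grid J = {- int J<..<int J}"
proof -
  have "\<bar>real_of_int j * step J\<bar> < 1 \<longleftrightarrow> \<bar>j\<bar> < int J" for j
  proof -
    have "\<bar>real_of_int j * step J\<bar> = of_int \<bar>j\<bar> / of_int (int J)" by (simp add: step_def abs_mult)
    also have "\<dots> < 1 \<longleftrightarrow> \<bar>j\<bar> < int J"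
      using assms by (simp only: divide_less_eq_1 of_int_less_iff of_int_0_less_iff) auto
    finally show ?thesis .
  qed
  then have "I_grid J = {j. \<bar>j\<bar> < int J}" unfolding I_grid_def by (simp only:)
  then show ?thesis by auto
qed

lemma discrete_maximum_principle:
  fixes U dU :: "int \<Rightarrow> real \<Rightarrow> real"
  assumes params: "0 < \<alpha>" "\<alpha> < 2" "- 1 < \<beta>" "\<beta> < 1" and "T > 0" and "J \<ge> 1"
    and N: "\<And>x. x \<in> {-1<..<1} \<Longrightarrow> N_hat \<alpha> \<beta> f g \<sigma> x \<le> 0"
    and C2: "\<And>x. x \<in> {-1<..<1} \<Longrightarrow> C2 \<alpha> \<beta> \<sigma> x \<ge> 0"
    and cont: "\<And>j. continuous_on {0..T} (U j)"
    and deriv: "\<And>j t. t \<in> {0<..T} \<Longrightarrow> (U j has_real_derivative dU j t) (at t within {0..T})"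
    and sub: "\<And>j t. j \<in> I_grid J \<Longrightarrow> t \<in> {0<..T} \<Longrightarrow> dU j t \<le> op_R \<alpha> \<beta> f g \<sigma> J (\<lambda>k. U k t) j"
    and zero: "\<And>j t. t \<in> {0..T} \<Longrightarrow> \<bar>j\<bar> \<ge> int J \<Longrightarrow> U j t = 0"
  shows "\<exists>m. is_max_over (\<lambda>(j, t). U j t) (UNIV \<times> {0..T}) m \<and>
             is_max_over (\<lambda>(j, t). U j t) (bdry_I_cyl J T) m"
proof -
  note I = I_grid_eq[OF \<open>J \<ge> 1\<close>]
  \<comment> \<open>The value 0 taken at the outer nodes is included; it also makes \<open>b\<close>
    nonnegative, so the sign of \<open>N_hat\<close> can be used wherever \<open>U\<close> is at
    least \<open>b\<close>.\<close>
  define b where "b = Max (insert 0 ((\<lambda>j. U j 0) ` I_grid J))"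
  have fin: "finite (insert 0 ((\<lambda>j. U j 0) ` I_grid J))" by (simp add: I)
  have "b \<ge> 0" unfolding b_def by (rule Max_ge[OF fin]) simp
  have init: "U j 0 \<le> b" if "j \<in> I_grid J" for j
    unfolding b_def by (rule Max_ge[OF fin]) (use that in simp)
  have bound: "U j t \<le> b" if "t \<in> {0..T}" for j t
  proof (rule bounded_by_initial_and_outer_values[where I = "I_grid J" and T = T and U = U and dU = dU])
    show "finite (I_grid J)" by (simp add: I)
    show "U j t \<le> b" if "j \<notin> I_grid J" "t \<in> {0..T}" for j t
      using zero[OF that(2), of j] that(1) \<open>b \<ge> 0\<close> by (force simp: I)
    show "dU j t \<le> 0" if "j \<in> I_grid J" "t \<in> {0<..T}" "\<And>k. U k t \<le> U j t" "b \<le> U j t" for j t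
    proof -
      have "gridpt J j \<in> {-1<..<1}" using that(1) by (auto simp: I_grid_def gridpt_def)
      then have "op_R \<alpha> \<beta> f g \<sigma> J (\<lambda>k. U k t) j \<le> 0"
        using params \<open>J \<ge> 1\<close> N C2 that(3,4) \<open>b \<ge> 0\<close> by (intro op_R_nonpos_at_max) auto
      then show ?thesis using sub[OF that(1,2)] by simp
    qed
  qed (use cont deriv init that in auto)
  have "b \<in> insert 0 ((\<lambda>j. U j 0) ` I_grid J)" unfolding b_def by (rule Max_in[OF fin]) simp
  \<comment> \<open>If \<open>b\<close> is 0, it is attained at the outer node \<open>J\<close> at
    time 0; otherwise it is an initial value.\<close>
  moreover have "U (int J) 0 = 0" using zero[of 0 "int J"] \<open>T > 0\<close> by simp
  ultimately obtain j where "U j 0 = b" by auto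
  moreover have "(j, 0) \<in> bdry_I_cyl J T" using \<open>T > 0\<close> by (simp add: bdry_I_cyl_def I_cyl_def)
  ultimately have "is_max_over (\<lambda>(j, t). U j t) (bdry_I_cyl J T) b"
    using bound by (auto simp: is_max_over_def bdry_I_cyl_def intro!: bexI[of _ "(j, 0)"])
  moreover have "is_max_over (\<lambda>(j, t). U j t) (UNIV \<times> {0..T}) b"
    using bound \<open>U j 0 = b\<close> \<open>T > 0\<close> by (fastforce simp: is_max_over_def)
  ultimately show ?thesis by blast
qed

theorem proposition4p1:
  fixes \<alpha> \<beta> T :: real and J :: nat
    and f g \<sigma> :: "real \<Rightarrow> real"
    and U dU :: "int \<Rightarrow> real \<Rightarrow> real"
  assumes "0 < \<alpha>" "\<alpha> < 2" and "-1 < \<beta>" "\<beta> < 1" and "T > 0" and "J \<ge> 1"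
    and "\<And>x. \<sigma> x \<noteq> 0"
    and "\<And>x. x \<in> {-1<..<1} \<Longrightarrow> f differentiable (at x)"
    and "\<And>x. x \<in> {-1<..<1} \<Longrightarrow> g differentiable (at x) \<and> deriv g differentiable (at x)"
    and "\<And>x. x \<in> {-1<..<1} \<Longrightarrow> \<sigma> differentiable (at x) \<and> deriv \<sigma> differentiable (at x)"
    and "scheme_well_defined \<alpha> \<sigma> J"
    and "\<And>x. x \<in> {-1<..<1} \<Longrightarrow> N_hat \<alpha> \<beta> f g \<sigma> x \<le> 0"
    and "\<And>x. x \<in> {-1<..<1} \<Longrightarrow> C2 \<alpha> \<beta> \<sigma> x \<ge> 0"
    and "\<And>j. continuous_on {0..T} (U j)"
    and "\<And>j t. t \<in> {0<..T} \<Longrightarrow> (U j has_real_derivative dU j t) (at t within {0..T})"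
  shows
    "((\<forall>(j, t)\<in>I_cyl J T. dU j t - op_R \<alpha> \<beta> f g \<sigma> J (\<lambda>k. U k t) j \<le> 0) \<and>
      (\<forall>j. \<forall>t\<in>{0..T}. \<bar>j\<bar> \<ge> int J \<longrightarrow> U j t = 0) \<longrightarrow>
      (\<exists>m. is_max_over (\<lambda>(j, t). U j t) (UNIV \<times> {0..T}) m \<and>
           is_max_over (\<lambda>(j, t). U j t) (bdry_I_cyl J T) m)) \<and>
     ((\<forall>(j, t)\<in>I_cyl J T. dU j t - op_R \<alpha> \<beta> f g \<sigma> J (\<lambda>k. U k t) j \<ge> 0) \<and>
      (\<forall>j. \<forall>t\<in>{0..T}. \<bar>j\<bar> \<ge> int J \<longrightarrow> U j t = 0) \<longrightarrow>
      (\<exists>m. is_min_over (\<lambda>(j, t). U j t) (UNIV \<times> {0..T}) m \<and>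
           is_min_over (\<lambda>(j, t). U j t) (bdry_I_cyl J T) m))"
proof (intro conjI impI; elim conjE)
  note assms' = assms(1-6,12,13)
  assume le: "\<forall>(j, t)\<in>I_cyl J T. dU j t - op_R \<alpha> \<beta> f g \<sigma> J (\<lambda>k. U k t) j \<le> 0"
    and zero: "\<forall>j. \<forall>t\<in>{0..T}. \<bar>j\<bar> \<ge> int J \<longrightarrow> U j t = 0"
  show "\<exists>m. is_max_over (\<lambda>(j, t). U j t) (UNIV \<times> {0..T}) m \<and>
            is_max_over (\<lambda>(j, t). U j t) (bdry_I_cyl J T) m"
    by (rule discrete_maximum_principle[OF assms', where U = U and dU = dU])
      (use assms(14,15) le zero in \<open>auto simp: I_cyl_def\<close>)
next
  note assms' = assms(1-6,12,13)
  assume ge: "\<forall>(j, t)\<in>I_cyl J T. dU j t - op_R \<alpha> \<beta> f g \<sigma> J (\<lambda>k. U k t) j \<ge> 0"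
    and zero: "\<forall>j. \<forall>t\<in>{0..T}. \<bar>j\<bar> \<ge> int J \<longrightarrow> U j t = 0"
  \<comment> \<open>The minimum principle is the maximum principle for -U, by oddness of the
    operator.\<close>
  have "\<exists>m. is_max_over (\<lambda>(j, t). - U j t) (UNIV \<times> {0..T}) m \<and>
            is_max_over (\<lambda>(j, t). - U j t) (bdry_I_cyl J T) m"
    by (rule discrete_maximum_principle[OF assms', where U = "\<lambda>j t. - U j t" and dU = "\<lambda>j t. - dU j t"])
      (use assms(14,15) ge zero in \<open>auto simp: I_cyl_def op_R_uminus intro!: continuous_intros derivative_intros\<close>)
  then obtain m where "is_max_over (\<lambda>(j, t). - U j t) (UNIV \<times> {0..T}) m"
    "is_max_over (\<lambda>(j, t). - U j t) (bdry_I_cyl J T) m" by blast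
  moreover have "is_min_over (\<lambda>(j, t). U j t) S (- m)" if "is_max_over (\<lambda>(j, t). - U j t) S m" for S
    using that by (auto simp: is_max_over_def is_min_over_def case_prod_unfold minus_le_iff intro: rev_bexI)
  ultimately show "\<exists>m. is_min_over (\<lambda>(j, t). U j t) (UNIV \<times> {0..T}) m \<and>
            is_min_over (\<lambda>(j, t). U j t) (bdry_I_cyl J T) m" by blast
qed

end
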